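(* Let $Q$ be a nonzero commutative unital ring, let $n$ be a positive integer and let $\mathbf w=(w_1,\ldots,w_n)\in\mathbb Z_{\ge1}^n$. Let $R_{\mathbf w}$ be the Rees ring of $\mathbf w$ over $Q$ and $d_{\mathbf w}=\operatorname{lcm}(w_1,\ldots,w_n)$. Let $N$ be the least length among well-formed vectors strongly equivalent to $\mathbf w$. Then for every integer $k\ge\max(1,N-2)$, the graded ring $R_{\mathbf w}^{(kd_{\mathbf w})}$ is generated in degree $1$.
   Context: The Rees ring is the subring $R_{\mathbf w}:=Q[\{t^dx_i\mid i\in\{1,\ldots,n\},\ d\in\{0,\ldots,w_i\}\}]$ of the polynomial ring $Q[t,x_1,\ldots,x_n]$, graded by the degree in $t$ (so $x_1,\dots,x_n$ have degree $0$); equivalently it is the nonnegative-degree part of $Q[t^{-1},t^{w_1}x_1,\ldots,t^{w_n}x_n]$. Its degree-zero part is $Q[x_1,\ldots,x_n]$. For a $\mathbb Z_{\ge0}$-graded ring $S$ and an integer $r\ge1$, the $r$th Veronese subring is $S^{(r)}:=\bigoplus_{m\ge0}S_{rm}$, where $S_{rm}$ is the $m$th graded component of $S^{(r)}$. A graded ring $S$ is generated in degree $1$ if $S=S_0\oplus\bigoplus_{m\ge1}S_1^m$, where $S_1^m$ is the additive subgroup generated by $m$-fold products of elements of $S_1$. A vector $\mathbf v=(v_1,\ldots,v_m)$ of positive integers is well-formed if $m=v_1=1$ or $\gcd(\{v_i\mid i\in I\})=1$ for every $(m-1)$-element subset $I$ of $\{1,\ldots,m\}$. Consider the following operations on a nonempty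 vector of positive integers: (1) permuting the entries; (2) adding or removing repeated entries; (3) multiplying all entries by the same positive integer or dividing all entries by a positive common divisor; (4) adding or removing entries equal to the least common multiple of the entries while not changing the least common multiple. Two nonempty vectors of positive integers are strongly equivalent if they become equal after applying a suitable choice of any number of the operations (1)–(4). *)

theory Defs
  imports "HOL-Library.Multiset" "HOL-Library.Poly_Mapping" "HOL-Computational_Algebra.Group_Closure"
begin

section \<open>Direct sums and graded rings inside an ambient commutative ring\<close>

definition is_direct_sum :: "'b::ab_group_add set \<Rightarrow> (nat \<Rightarrow> 'b set) \<Rightarrow> bool" where
  "is_direct_sum A F \<longleftrightarrow>
     (\<forall>m. group_closure (F m) = F m) \<and>
     A = group_closure (\<Union>m. F m) \<and>
     (\<forall>M f. finite M \<longrightarrow> (\<forall>m\<in>M. f m \<in> F m) \<longrightarrow> (\<Sum>m\<in>M. f m) = 0 \<longrightarrow> (\<forall>m\<in>M. f m = 0))"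

text \<open>
  A nonnegatively graded ring is represented by the family of its graded components
  inside an ambient commutative ring; the underlying ring is then \<open>graded_carrier\<close>.
\<close>

definition graded_carrier :: "(nat \<Rightarrow> 'b::comm_ring_1 set) \<Rightarrow> 'b set" where
  "graded_carrier S = group_closure (\<Union>m. S m)"

definition graded_ring :: "(nat \<Rightarrow> 'b::comm_ring_1 set) \<Rightarrow> bool" where
  "graded_ring S \<longleftrightarrow> is_direct_sum (graded_carrier S) S \<and> 1 \<in> S 0 \<and>
     (\<forall>i j. \<forall>a\<in>S i. \<forall>b\<in>S j. a * b \<in> S (i + j))"

definition veronese :: "nat \<Rightarrow> (nat \<Rightarrow> 'b::comm_ring_1 set) \<Rightarrow> nat \<Rightarrow> 'b set" where
  "veronese r S m = S (r * m)"

definition power_span :: "'b::comm_ring_1 set \<Rightarrow> nat \<Rightarrow> 'b set" where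
  "power_span A m = group_closure {prod_list as | as. length as = m \<and> set as \<subseteq> A}"

definition generated_in_degree_1 :: "(nat \<Rightarrow> 'b::comm_ring_1 set) \<Rightarrow> bool" where
  "generated_in_degree_1 S \<longleftrightarrow>
     is_direct_sum (graded_carrier S) (\<lambda>m. if m = 0 then S 0 else power_span (S 1) m)"


section \<open>The Rees ring\<close>

text \<open>
  Polynomials live in infinitely many variables \<open>T, X 0, X 1, \<dots>\<close>; the Rees ring of a vector
  of length \<open>n\<close> only involves \<open>T, X 0, \<dots>, X (n - 1)\<close>, with \<open>X i\<close> paired with the entry
  \<open>w ! i\<close> (so indices start at 0).
\<close>

datatype rees_var = T | X nat

type_synonym 'a rees_poly = "(rees_var \<Rightarrow>\<^sub>0 nat) \<Rightarrow>\<^sub>0 'a"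

definition var :: "rees_var \<Rightarrow> 'a::comm_ring_1 rees_poly" where
  "var v = Poly_Mapping.single (Poly_Mapping.single v 1) 1"

text \<open>The subring generated by the constants and \<open>G\<close>; it is closed under negation because
  \<open>-1\<close> is a constant.\<close>

inductive_set adjoin :: "'a::comm_ring_1 rees_poly set \<Rightarrow> 'a rees_poly set"
  for G :: "'a rees_poly set" where
  const: "Poly_Mapping.single 0 c \<in> adjoin G"
| gen: "g \<in> G \<Longrightarrow> g \<in> adjoin G"
| add: "p \<in> adjoin G \<Longrightarrow> q \<in> adjoin G \<Longrightarrow> p + q \<in> adjoin G"
| mult: "p \<in> adjoin G \<Longrightarrow> q \<in> adjoin G \<Longrightarrow> p * q \<in> adjoin G"

definition rees_ring :: "nat list \<Rightarrow> 'a::comm_ring_1 rees_poly set" where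
  "rees_ring w = adjoin {var T ^ d * var (X i) | d i. i < length w \<and> d \<le> w ! i}"

definition rees_component :: "nat list \<Rightarrow> nat \<Rightarrow> 'a::comm_ring_1 rees_poly set" where
  "rees_component w d =
     {p \<in> rees_ring w. \<forall>m \<in> Poly_Mapping.keys p. Poly_Mapping.lookup m T = d}"

lemma var_T_power:
  "var T ^ d = (Poly_Mapping.single (Poly_Mapping.single T d) 1 :: 'a::comm_ring_1 rees_poly)"
proof (induction d)
  case (Suc d)
  have "Poly_Mapping.single T 1 + Poly_Mapping.single T d = Poly_Mapping.single T (Suc d)"
    by (simp flip: single_add)
  then show ?case unfolding power_Suc Suc.IH by (simp add: var_def mult_single)
qed simp

lemma rees_ring_diff:
  assumes "p \<in> rees_ring w" "q \<in> rees_ring w"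
  shows "p - q \<in> rees_ring w"
proof -
  have "Poly_Mapping.single 0 (- 1) * q \<in> rees_ring w"
    using assms unfolding rees_ring_def by (intro adjoin.mult adjoin.const)
  moreover have "Poly_Mapping.single 0 (- 1) * q = - q"
    by (simp add: single_uminus)
  ultimately show ?thesis
    using assms adjoin.add[of p _ "- q"] unfolding rees_ring_def by simp
qed

lemma rees_component_subgroup: "group_closure (rees_component w d) = rees_component w d"
proof
  show "rees_component w d \<subseteq> group_closure (rees_component w d)"
    by (auto intro: group_closure.base)
  have z: "0 \<in> rees_ring w"
    unfolding rees_ring_def using adjoin.const[of 0] by simp
  show "group_closure (rees_component w d) \<subseteq> rees_component w d"
  proof
    fix p assume "p \<in> group_closure (rees_component w d)"
    then show "p \<in> rees_component w d"
    proof induction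
      case (base s)
      then show ?case using z by (auto simp: rees_component_def)
    next
      case (diff s t)
      then show ?case
        using keys_diff[of s t] by (auto simp: rees_component_def rees_ring_diff)
    qed
  qed
qed

lemma rees_component_mult:
  assumes "p \<in> rees_component w i" "q \<in> rees_component w j"
  shows "p * q \<in> rees_component w (i + j)"
proof -
  have "p * q \<in> rees_ring w"
    using assms unfolding rees_component_def rees_ring_def by (blast intro: adjoin.mult)
  moreover have "Poly_Mapping.lookup m T = i + j" if m: "m \<in> Poly_Mapping.keys (p * q)" for m
  proof -
    obtain a b where "m = a + b" "a \<in> Poly_Mapping.keys p" "b \<in> Poly_Mapping.keys q"
      using m keys_mult[of p q] by blast
    then show ?thesis using assms by (simp add: rees_component_def lookup_add)
  qed
  ultimately show ?thesis by (simp add: rees_component_def)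
qed

lemma group_closure_mult_closed:
  fixes A :: "'b::comm_ring_1 set"
  assumes A: "\<And>a b. a \<in> A \<Longrightarrow> b \<in> A \<Longrightarrow> a * b \<in> A"
    and "p \<in> group_closure A" "q \<in> group_closure A"
  shows "p * q \<in> group_closure A"
  using assms(2)
proof induction
  case (base s)
  from assms(3) show ?case
  proof induction
    case (base t)
    then show ?case using \<open>s \<in> insert 0 A\<close> by (auto intro: group_closure.base A)
  next
    case (diff t u)
    then show ?case by (simp add: right_diff_distrib group_closure.diff)
  qed
next
  case (diff s t)
  then show ?case by (simp add: left_diff_distrib group_closure.diff)
qed

lemma rees_graded_carrier: "graded_carrier (rees_component w) = rees_ring w"
proof
  have "p \<in> rees_ring w" if "p \<in> group_closure (\<Union>m. rees_component w m)" for p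
    using that
  proof induction
    case (base s)
    then show ?case
      using adjoin.const[of 0] by (auto simp: rees_component_def rees_ring_def)
  qed (rule rees_ring_diff)
  then show "graded_carrier (rees_component w) \<subseteq> rees_ring w"
    by (auto simp: graded_carrier_def)
next
  let ?C = "group_closure (\<Union>m. rees_component w m)"
  have "p \<in> ?C" if p: "p \<in> adjoin {var T ^ d * var (X i) | d i. i < length w \<and> d \<le> w ! i}"
    for p :: "'a rees_poly"
    using p
  proof induction
    case (const c)
    have "Poly_Mapping.single 0 c \<in> rees_component w 0"
      by (auto simp: rees_component_def rees_ring_def adjoin.const)
    then show ?case by (auto intro: group_closure.base)
  next
    case (gen g)
    then obtain d i where g: "g = var T ^ d * var (X i)" "i < length w" "d \<le> w ! i" by blast
    have "g \<in> rees_ring w" unfolding rees_ring_def using gen by (rule adjoin.gen)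
    moreover have "g = Poly_Mapping.single (Poly_Mapping.single T d + Poly_Mapping.single (X i) 1) 1"
      unfolding g var_T_power by (simp add: var_def mult_single)
    ultimately have "g \<in> rees_component w d"
      by (auto simp: rees_component_def lookup_add lookup_single)
    then show ?case by (auto intro: group_closure.base)
  next
    case (add p q)
    then show ?case by (simp add: group_closure_add)
  next
    case (mult p q)
    show ?case
    proof (rule group_closure_mult_closed[OF _ mult.IH])
      fix a b :: "'a rees_poly"
      assume "a \<in> (\<Union>m. rees_component w m)" "b \<in> (\<Union>m. rees_component w m)"
      then obtain i j where "a \<in> rees_component w i" "b \<in> rees_component w j" by auto
      then have "a * b \<in> rees_component w (i + j)" by (rule rees_component_mult)
      then show "a * b \<in> (\<Union>m. rees_component w m)" by auto
    qed
  qed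
  then show "(rees_ring w :: 'a rees_poly set) \<subseteq> graded_carrier (rees_component w)"
    unfolding rees_ring_def graded_carrier_def by auto
qed

lemma graded_ring_rees: "graded_ring (rees_component w :: nat \<Rightarrow> 'a::comm_ring_1 rees_poly set)"
proof -
  have "f m = 0"
    if fin: "finite M" and f: "\<forall>m\<in>M. f m \<in> rees_component w m"
      and s: "(\<Sum>m\<in>M. f m) = 0" and m: "m \<in> M" for M and f :: "nat \<Rightarrow> 'a rees_poly" and m
  proof (rule ccontr)
    assume "f m \<noteq> 0"
    then obtain k where k: "k \<in> Poly_Mapping.keys (f m)" by fastforce
    have "Poly_Mapping.lookup (f j) k = 0" if "j \<in> M - {m}" for j
    proof (rule ccontr)
      assume "\<not> ?thesis"
      then have "k \<in> Poly_Mapping.keys (f j)" by (simp add: in_keys_iff)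
      then have "Poly_Mapping.lookup k T = j" "Poly_Mapping.lookup k T = m"
        using that f m k unfolding rees_component_def by blast+
      then show False using that by simp
    qed
    then have "Poly_Mapping.lookup (\<Sum>m\<in>M. f m) k = Poly_Mapping.lookup (f m) k"
      by (simp add: sum.remove[OF fin m] lookup_add lookup_sum)
    with s k show False by (simp add: in_keys_iff)
  qed
  moreover have "(1 :: 'a rees_poly) \<in> rees_component w 0"
    using adjoin.const[of "1::'a"] by (auto simp: rees_component_def rees_ring_def)
  ultimately show ?thesis
    unfolding graded_ring_def is_direct_sum_def rees_component_subgroup graded_carrier_def
    by (intro conjI allI ballI impI refl rees_component_mult) blast+
qed


section \<open>Well-formed vectors and strong equivalence\<close>

definition pos_vec :: "nat list \<Rightarrow> bool" where
  "pos_vec v \<longleftrightarrow> v \<noteq> [] \<and> (\<forall>a\<in>set v. 0 < a)"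

text \<open>Note \<open>Gcd {} = 0\<close>, so the second alternative fails for vectors of length 1.\<close>

definition well_formed :: "nat list \<Rightarrow> bool" where
  "well_formed v \<longleftrightarrow> pos_vec v \<and>
     (length v = 1 \<and> v ! 0 = 1 \<or>
      (\<forall>I. I \<subseteq> {..<length v} \<and> card I = length v - 1 \<longrightarrow> Gcd ((\<lambda>i. v ! i) ` I) = 1))"

text \<open>
  \<open>basic_op\<close> contains the adding and multiplying forms of the operations; \<open>strong_op\<close> also allows
  their inverses (removing, dividing). In the rule \<open>lcm\<close>, inserting or deleting the entry leaves
  the least common multiple unchanged, since it equals the least common multiple of the
  remaining entries.
\<close>

inductive basic_op :: "nat list \<Rightarrow> nat list \<Rightarrow> bool" where
  permute: "mset v = mset v' \<Longrightarrow> basic_op v v'"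
| repeat: "a \<in> set (xs @ ys) \<Longrightarrow> basic_op (xs @ ys) (xs @ a # ys)"
| scale: "0 < c \<Longrightarrow> basic_op v (map (\<lambda>a. c * a) v)"
| lcm: "basic_op (xs @ ys) (xs @ Lcm (set (xs @ ys)) # ys)"

definition strong_op :: "nat list \<Rightarrow> nat list \<Rightarrow> bool" where
  "strong_op v v' \<longleftrightarrow> pos_vec v \<and> pos_vec v' \<and> (basic_op v v' \<or> basic_op v' v)"

definition strongly_equivalent :: "nat list \<Rightarrow> nat list \<Rightarrow> bool" where
  "strongly_equivalent v v' \<longleftrightarrow> pos_vec v \<and> pos_vec v' \<and>
     (\<exists>u. strong_op\<^sup>*\<^sup>* v u \<and> strong_op\<^sup>*\<^sup>* v' u)"

definition min_wf_length :: "nat list \<Rightarrow> nat" where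
  "min_wf_length w = (LEAST N. \<exists>v. well_formed v \<and> strongly_equivalent v w \<and> length v = N)"

lemma well_formed_double:
  assumes "pos_vec v" "Gcd (set v) = 1"
  shows "well_formed (v @ v)"
proof -
  have "Gcd ((\<lambda>i. (v @ v) ! i) ` I) = 1"
    if I: "I \<subseteq> {..<length (v @ v)}" "card I = length (v @ v) - 1" for I
  proof -
    have ne: "0 < length v" using assms(1) by (auto simp: pos_vec_def)
    have "card ({..<length (v @ v)} - I) = 1"
      using I ne card_Diff_subset[of I "{..<length (v @ v)}"] finite_subset[OF I(1)]
      by (cases "length v") auto
    then obtain j where j: "{..<length (v @ v)} - I = {j}" by (auto simp: card_1_singleton_iff)
    have "set v \<subseteq> (\<lambda>i. (v @ v) ! i) ` I"
    proof
      fix a assume "a \<in> set v"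
      then obtain i where i: "i < length v" "a = v ! i" by (auto simp: in_set_conv_nth)
      have "i \<in> I \<or> i + length v \<in> I"
      proof (rule ccontr)
        assume "\<not> ?thesis"
        then have "i \<in> {..<length (v @ v)} - I" "i + length v \<in> {..<length (v @ v)} - I"
          using i by auto
        then show False using ne unfolding j by simp
      qed
      then show "a \<in> (\<lambda>i. (v @ v) ! i) ` I"
        using i by (auto simp: nth_append intro: rev_image_eqI)
    qed
    moreover have "(\<lambda>i. (v @ v) ! i) ` I \<subseteq> set (v @ v)"
      using I(1) nth_mem[of _ "v @ v"] by (auto simp del: set_append)
    ultimately have "(\<lambda>i. (v @ v) ! i) ` I = set v" by auto
    then show ?thesis using assms(2) by simp
  qed
  then show ?thesis using assms(1) unfolding well_formed_def by (auto simp: pos_vec_def)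
qed

lemma strong_op_repeat:
  assumes "pos_vec v" "set xs \<subseteq> set v"
  shows "strong_op\<^sup>*\<^sup>* v (v @ xs)"
  using assms(2)
proof (induction xs rule: rev_induct)
  case (snoc x xs)
  have "basic_op ((v @ xs) @ []) ((v @ xs) @ x # [])"
    using snoc.prems by (intro basic_op.repeat) auto
  then have "strong_op (v @ xs) (v @ xs @ [x])"
    using assms(1) snoc.prems by (auto simp: strong_op_def pos_vec_def)
  with snoc show ?case by (auto intro: rtranclp.rtrancl_into_rtrancl)
qed simp

text \<open>The set of lengths minimised in \<open>min_wf_length\<close> is nonempty.\<close>

lemma well_formed_strongly_equivalent_exists:
  assumes "pos_vec w"
  shows "\<exists>v. well_formed v \<and> strongly_equivalent v w"
proof -
  define g where "g = Gcd (set w)"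
  define v where "v = map (\<lambda>a. a div g) w"
  have g: "0 < g" using assms by (cases w) (auto simp: g_def pos_vec_def)
  have w: "w = map (\<lambda>a. g * a) v"
    unfolding v_def g_def by (simp add: map_idI)
  have pv: "pos_vec v"
  proof -
    have "0 < a" if "a \<in> set v" for a
    proof -
      have "g * a \<in> set w" using that by (subst w) auto
      then show ?thesis using assms unfolding pos_vec_def by fastforce
    qed
    then show ?thesis using assms by (simp add: pos_vec_def v_def)
  qed
  have "g = Gcd ((\<lambda>a. g * a) ` set v)"
    using arg_cong[OF w, of "\<lambda>x. Gcd (set x)"] unfolding g_def[symmetric] set_map .
  also have "\<dots> = g * Gcd (set v)" by (simp add: Gcd_mult)
  finally have "g = g * Gcd (set v)" .
  then have "Gcd (set v) = 1" using g by simp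
  then have wf: "well_formed (v @ v)" using pv by (rule well_formed_double[rotated])
  have "basic_op v w" unfolding w using g by (rule basic_op.scale)
  then have "strong_op w v" using assms pv by (simp add: strong_op_def)
  then have "strong_op\<^sup>*\<^sup>* w (v @ v)"
    using strong_op_repeat[OF pv, of v] by (auto intro: converse_rtranclp_into_rtranclp)
  then have "strongly_equivalent (v @ v) w"
    using wf assms unfolding strongly_equivalent_def by (auto simp: well_formed_def)
  with wf show ?thesis by blast
qed

end

theory Submission
  imports Defs "HOL-Library.FuncSet"
begin

text \<open>
  The Rees ring is spanned by the monomials \<open>T^e x^a\<close> with \<open>e \<le> a \<bullet> w\<close>, so it suffices to split off
  from every \<open>a\<close> with \<open>a \<bullet> w \<ge> 2 k d\<close> some \<open>b \<le> a\<close> with \<open>b \<bullet> w = k d\<close>. After adding the weight \<open>d\<close>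
  this depends only on the set of quotients \<open>d / w\<^sub>i\<close>, which is a strong equivalence invariant, so
  \<open>w\<close> may be replaced by a well-formed \<open>v\<close> of length \<open>N\<close>. Remove from \<open>a\<close> as many pieces of weight
  exactly \<open>d\<close> as possible. If fewer than \<open>k\<close> come off, the remainder has entries
  \<open>a\<^sub>i < c\<^sub>i = d / v\<^sub>i\<close> and weight at least \<open>(k + 1) d\<close> but less than \<open>N d\<close>, which forces
  \<open>N = k + 2\<close>, and it remains to find \<open>b \<le> a\<close> whose weight is \<open>j d\<close> with \<open>1 \<le> j \<le> k\<close>.
  Such \<open>b\<close> exists by counting: well-formedness makes the projections of the finite group
  \<open>{b \<in> \<Prod> \<int>/c\<^sub>i. d dvd b \<bullet> v}\<close> to the factors surjective, hence equidistributed, and a union bound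
  leaves at least \<open>N \<ge> 3\<close> of its elements in the box below \<open>a\<close>.
\<close>

section \<open>An invariant of strong equivalence\<close>

text \<open>Inserting 1 makes the set blind to an added or removed entry equal to the least common
  multiple, whose quotient is 1.\<close>

definition denominators :: "nat list \<Rightarrow> nat set" where
  "denominators v = insert 1 ((\<lambda>a. Lcm (set v) div a) ` set v)"

lemma Lcm_pos_vec: "pos_vec v \<Longrightarrow> 0 < Lcm (set v)"
  by (auto simp: pos_vec_def intro!: Nat.gr0I) 

text \<open>Permuting and repeating keep the set of entries; scaling multiplies the entries and
  their least common multiple by the same factor, which cancels in the quotients.\<close>

lemma basic_op_denominators:
  assumes "basic_op v v'" "pos_vec v" "pos_vec v'"
  shows "denominators v = denominators v'"
  using assms
proof cases
  case permute
  then have "set v = set v'" by (metis set_mset_mset)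
  then show ?thesis by (simp add: denominators_def)
next
  case (repeat a xs ys)
  then have "set v = set v'" by auto
  then show ?thesis by (simp add: denominators_def)
next
  case (scale c)
  have "Lcm (set v') = c * Lcm (set v)"
    using scale assms(2) by (simp add: Lcm_mult pos_vec_def)
  then show ?thesis using scale by (auto simp: denominators_def image_image)
next
  case (lcm xs ys)
  let ?L = "Lcm (set (xs @ ys))"
  have "set v' = insert ?L (set v)" using lcm by auto
  moreover have "Lcm (insert ?L (set v)) = ?L"
    using lcm by simp
  moreover have "?L div ?L = 1" using Lcm_pos_vec[OF assms(2)] lcm by (metis div_self neq0_conv)
  ultimately show ?thesis using lcm by (simp add: denominators_def)
qed

lemma strongly_equivalent_denominators:
  assumes "strongly_equivalent v w"
  shows "denominators v = denominators w"
proof -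
  have "denominators v = denominators u" if "strong_op\<^sup>*\<^sup>* v u" for v u
    using that
    by induction (auto simp: strong_op_def dest: basic_op_denominators)
  then show ?thesis using assms unfolding strongly_equivalent_def by metis
qed

section \<open>Counting solutions of a linear congruence in a box\<close>

lemma Gcd_bezout:
  fixes v :: "nat \<Rightarrow> nat"
  assumes "finite I"
  shows "\<exists>y. (\<Sum>j\<in>I. y j * int (v j)) = int (Gcd (v ` I))"
  using assms
proof induction
  case (insert i I)
  then obtain y where y: "(\<Sum>j\<in>I. y j * int (v j)) = int (Gcd (v ` I))" by blast
  obtain a b where ab: "a * int (v i) + b * int (Gcd (v ` I)) = gcd (int (v i)) (int (Gcd (v ` I)))"
    using bezout_int by blast
  have "(\<Sum>j\<in>insert i I. (if j = i then a else b * y j) * int (v j))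
      = a * int (v i) + (\<Sum>j\<in>I. (if j = i then a else b * y j) * int (v j))"
    using insert by simp
  also have "(\<Sum>j\<in>I. (if j = i then a else b * y j) * int (v j)) = b * (\<Sum>j\<in>I. y j * int (v j))"
    using insert(2) unfolding sum_distrib_left by (intro sum.cong) auto
  finally have "(\<Sum>j\<in>insert i I. (if j = i then a else b * y j) * int (v j)) = int (Gcd (v ` insert i I))"
    using y ab by simp
  then show ?case by (rule exI[of _ "\<lambda>j. if j = i then a else b * y j"])
qed simp

text \<open>Here \<open>gcd_others\<close> is well-formedness, and \<open>c i\<close> copies of the
  index \<open>i\<close> weigh exactly \<open>d\<close>.\<close>

locale weighted_box =
  fixes N d :: nat and v c :: "nat \<Rightarrow> nat"
  assumes vc: "i < N \<Longrightarrow> v i * c i = d"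
    and d_pos: "0 < d"
    and gcd_others: "i < N \<Longrightarrow> Gcd (v ` ({..<N} - {i})) = 1"
begin

definition wt :: "(nat \<Rightarrow> int) \<Rightarrow> int" where
  "wt b = (\<Sum>i<N. b i * int (v i))"

text \<open>As \<open>v i * c i = d\<close>, divisibility of the weight by \<open>d\<close> depends
  only on the residues of \<open>b i\<close> modulo \<open>c i\<close>; the box holds
  representatives of a subgroup of the product of the \<int>/\<open>c i\<close>. Extensionality
  makes vectors equal once they agree below \<open>N\<close>.\<close>

definition sols :: "(nat \<Rightarrow> int) set" where
  "sols = {b \<in> Pi\<^sub>E {..<N} (\<lambda>i. {0..<int (c i)}). int d dvd wt b}"

lemma c_pos: "i < N \<Longrightarrow> 0 < c i"
  using vc d_pos by (metis mult_0_right neq0_conv)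

lemma finite_sols: "finite sols"
  unfolding sols_def by (rule finite_subset[of _ "Pi\<^sub>E {..<N} (\<lambda>i. {0..<int (c i)})"])
    (auto intro: finite_PiE)

lemma zero_in_sols: "(\<lambda>i\<in>{..<N}. 0) \<in> sols"
  using c_pos by (auto simp: sols_def wt_def)

text \<open>Reducing entry \<open>i\<close> changes the weight by a multiple of
  \<open>c i * v i = d\<close>.\<close>

lemma wt_mod: "int d dvd wt (\<lambda>i\<in>{..<N}. b i mod int (c i)) - wt b"
proof -
  have "int d dvd (b i mod int (c i)) * int (v i) - b i * int (v i)" if "i < N" for i
  proof -
    have "(b i mod int (c i)) * int (v i) - b i * int (v i)
        = - (b i div int (c i)) * (int (v i) * int (c i))"
      by (simp add: minus_div_mult_eq_mod[symmetric] algebra_simps)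
    also have "int (v i) * int (c i) = int d" using vc[OF that] by (metis of_nat_mult)
    finally show ?thesis by simp
  qed
  then show ?thesis unfolding wt_def sum_subtractf[symmetric] by (auto intro!: dvd_sum)
qed

text \<open>Since the other weights are coprime, some integral vector of weight 0 has entry 1 at \<open>i\<close>;
  translation by its multiples permutes the fibres of the \<open>i\<close>-th projection.\<close>

lemma fibre_card_le:
  assumes i: "i < N" and x: "0 \<le> x" "x < int (c i)" and y: "0 \<le> y" "y < int (c i)"
  shows "card {b \<in> sols. b i = x} \<le> card {b \<in> sols. b i = y}"
proof -
  obtain g where g: "(\<Sum>j\<in>{..<N} - {i}. g j * int (v j)) = 1"
    using Gcd_bezout[of "{..<N} - {i}" v] gcd_others[OF i] by auto
  \<comment> \<open>The Bezout combination \<open>g\<close> of the other weights, scaled by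
    \<open>- int (v i)\<close>, cancels the weight of the entry 1 at \<open>i\<close>.\<close>
  define h where "h j = (if j = i then 1 else - int (v i) * g j)" for j
  have hi: "h i = 1" by (simp add: h_def)
  have "wt h = h i * int (v i) + (\<Sum>j\<in>{..<N} - {i}. h j * int (v j))"
    unfolding wt_def using i by (intro sum.remove) auto
  also have "(\<Sum>j\<in>{..<N} - {i}. h j * int (v j)) = - int (v i) * (\<Sum>j\<in>{..<N} - {i}. g j * int (v j))"
    unfolding sum_distrib_left by (intro sum.cong) (auto simp: h_def)
  finally have h: "wt h = 0" unfolding g using hi by simp
  define f where "f b = (\<lambda>j\<in>{..<N}. (b j + (y - x) * h j) mod int (c j))" for b
  have "inj_on f {b \<in> sols. b i = x}"
  proof (rule inj_onI)
    fix a b assume a: "a \<in> {b \<in> sols. b i = x}" and b: "b \<in> {b \<in> sols. b i = x}" and eq: "f a = f b"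
    have "a j = b j" if j: "j < N" for j
    proof -
      have "(a j + (y - x) * h j) mod int (c j) = (b j + (y - x) * h j) mod int (c j)"
        using fun_cong[OF eq, of j] j by (simp add: f_def)
      then have "a j mod int (c j) = b j mod int (c j)"
        by (metis add_diff_cancel_right' mod_diff_left_eq)
      moreover have "0 \<le> a j" "a j < int (c j)" "0 \<le> b j" "b j < int (c j)"
        using a b j by (auto simp: sols_def PiE_iff)
      ultimately show ?thesis by simp
    qed
    then show "a = b" using a b
      by (intro PiE_ext[of a "{..<N}" "\<lambda>i. {0..<int (c i)}" b]) (auto simp: sols_def)
  qed
  moreover have "f ` {b \<in> sols. b i = x} \<subseteq> {b \<in> sols. b i = y}"
  proof
    fix b' assume "b' \<in> f ` {b \<in> sols. b i = x}"
    then obtain b where b: "b \<in> sols" "b i = x" "b' = f b" by auto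
    have "wt (\<lambda>j. b j + (y - x) * h j) = wt b + (y - x) * wt h"
      unfolding wt_def sum_distrib_left sum.distrib[symmetric]
      by (intro sum.cong) (simp_all add: algebra_simps)
    then have "int d dvd wt (\<lambda>j. b j + (y - x) * h j)" using b h by (simp add: sols_def)
    then have "int d dvd wt (f b)"
      using wt_mod[of "\<lambda>j. b j + (y - x) * h j"] unfolding f_def
      by (metis dvd_add diff_add_cancel)
    moreover have "f b \<in> Pi\<^sub>E {..<N} (\<lambda>i. {0..<int (c i)})"
      using c_pos by (auto simp: f_def)
    moreover have "f b i = y" using i y b by (simp add: f_def h_def)
    ultimately show "b' \<in> {b \<in> sols. b i = y}" using b by (simp add: sols_def)
  qed
  ultimately show ?thesis
    using finite_sols by (intro card_inj_on_le) auto
qed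

section \<open>Equidistribution of the projections and the union bound\<close>

definition fibre :: "nat \<Rightarrow> nat" where
  "fibre i = card {b \<in> sols. b i = 0}"

lemma fibre_pos: "i < N \<Longrightarrow> 0 < fibre i"
  using zero_in_sols finite_sols by (auto simp: fibre_def card_gt_0_iff intro!: exI[of _ "\<lambda>i\<in>{..<N}. 0"])

text \<open>\<open>fibre_card_le\<close> in both directions makes all fibres of the
  \<open>i\<close>-th projection equal in size, so the one over 0 stands for all.\<close>

lemma card_slab:
  assumes "i < N" "A \<subseteq> {0..<int (c i)}"
  shows "card {b \<in> sols. b i \<in> A} = card A * fibre i"
proof -
  have fA: "finite A" using assms finite_subset by blast
  have "{b \<in> sols. b i \<in> A} = (\<Union>x\<in>A. {b \<in> sols. b i = x})" by auto
  also have "card \<dots> = (\<Sum>x\<in>A. card {b \<in> sols. b i = x})"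
    using fA finite_sols by (intro card_UN_disjoint) auto
  also have "\<dots> = (\<Sum>x\<in>A. fibre i)"
    using assms c_pos[OF assms(1)] unfolding fibre_def
    by (intro sum.cong refl antisym fibre_card_le) auto
  finally show ?thesis by simp
qed

lemma card_sols: "i < N \<Longrightarrow> card sols = c i * fibre i"
proof -
  assume i: "i < N"
  have "sols = {b \<in> sols. b i \<in> {0..<int (c i)}}" using i by (auto simp: sols_def PiE_iff)
  then show ?thesis using card_slab[OF i, of "{0..<int (c i)}"] by simp
qed

text \<open>Union bound: a solution not below \<open>a\<close> exceeds it at some \<open>i\<close>,
  which happens for exactly \<open>(c i - a i - 1) * fibre i\<close> solutions. Since
  \<open>d * fibre i = v i * card sols\<close>, the terms \<open>(c i - a i) * fibre i\<close> add
  up to \<open>card sols * (N * d - wt a) / d\<close>, at most \<open>card sols\<close>. What is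
  left as lower bound is one fibre per index.\<close>

lemma card_below:
  assumes a: "\<And>i. i < N \<Longrightarrow> 0 \<le> a i \<and> a i < int (c i)"
    and wt: "(int N - 1) * int d \<le> wt a"
  shows "N \<le> card {b \<in> sols. \<forall>i<N. b i \<le> a i}"
proof -
  let ?G = "{b \<in> sols. \<forall>i<N. b i \<le> a i}"
  let ?B = "\<lambda>i. {b \<in> sols. b i \<in> {a i<..<int (c i)}}"
  have "sols = ?G \<union> (\<Union>i<N. ?B i)"
    by (auto simp: sols_def PiE_iff not_le)
  then have "card sols = card (?G \<union> (\<Union>i<N. ?B i))" by (rule arg_cong)
  also have "\<dots> \<le> card ?G + card (\<Union>i<N. ?B i)" by (rule card_Un_le)
  also have "\<dots> \<le> card ?G + (\<Sum>i<N. card (?B i))" by (intro add_left_mono card_UN_le) simp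
  finally have "int (card sols) \<le> int (card ?G) + (\<Sum>i<N. int (card (?B i)))"
    unfolding of_nat_sum[symmetric] of_nat_add[symmetric] of_nat_le_iff .
  also have "(\<Sum>i<N. int (card (?B i))) = (\<Sum>i<N. (int (c i) - a i) * int (fibre i) - int (fibre i))"
  proof (intro sum.cong refl)
    fix i assume "i \<in> {..<N}"
    then have i: "i < N" by simp
    have "card (?B i) = card {a i<..<int (c i)} * fibre i"
      using i a[OF i] by (intro card_slab) auto
    also have "card {a i<..<int (c i)} = nat (int (c i) - a i - 1)"
      by (simp add: algebra_simps)
    finally show "int (card (?B i)) = (int (c i) - a i) * int (fibre i) - int (fibre i)"
      using a[OF i] by (simp add: algebra_simps)
  qed
  also have "\<dots> = (\<Sum>i<N. (int (c i) - a i) * int (fibre i)) - (\<Sum>i<N. int (fibre i))"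
    by (simp add: sum_subtractf)
  finally have *: "int (card sols) + (\<Sum>i<N. int (fibre i))
      \<le> int (card ?G) + (\<Sum>i<N. (int (c i) - a i) * int (fibre i))" by simp
  have "int d * (\<Sum>i<N. (int (c i) - a i) * int (fibre i))
      = (\<Sum>i<N. int (card sols) * (int d - a i * int (v i)))"
    unfolding sum_distrib_left
  proof (intro sum.cong refl)
    fix i assume "i \<in> {..<N}"
    then have i: "i < N" by simp
    have d: "int d = int (v i) * int (c i)" using vc[OF i] by (metis of_nat_mult)
    show "int d * ((int (c i) - a i) * int (fibre i)) = int (card sols) * (int d - a i * int (v i))"
      unfolding card_sols[OF i] d by (simp add: algebra_simps)
  qed
  also have "\<dots> = int (card sols) * (int N * int d - wt a)"
    unfolding wt_def by (simp add: sum_distrib_left[symmetric] sum_subtractf)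
  also have "\<dots> \<le> int (card sols) * int d"
    using wt by (intro mult_left_mono) (auto simp: algebra_simps)
  finally have "(\<Sum>i<N. (int (c i) - a i) * int (fibre i)) \<le> int (card sols)"
    using d_pos by (simp add: mult.commute)
  \<comment> \<open>Each fibre over 0 contains the zero vector, so the \<open>N\<close> fibres
    contribute at least \<open>N\<close>.\<close>
  moreover have "(\<Sum>i<N. 1) \<le> (\<Sum>i<N. int (fibre i))"
    using fibre_pos by (intro sum_mono) (auto simp: Suc_le_eq)
  ultimately show ?thesis using * by simp
qed

text \<open>If a solution below \<open>a\<close> has weight \<open>(N - 1) d\<close>, the bound \<open>card_below\<close> applies to the
  box below that solution and yields a third point there, distinct from \<open>0\<close> and the corner.\<close>

lemma intermediate_solution:
  assumes N: "3 \<le> N" and a: "\<And>i. i < N \<Longrightarrow> 0 \<le> a i \<and> a i < int (c i)"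
    and wt: "(int N - 1) * int d \<le> wt a"
  shows "\<exists>b j. (\<forall>i<N. 0 \<le> b i \<and> b i \<le> a i) \<and> 1 \<le> j \<and> j \<le> N - 2 \<and> wt b = int j * int d"
proof -
  let ?G = "\<lambda>a. {b \<in> sols. \<forall>i<N. b i \<le> a i}"
  let ?z = "\<lambda>i\<in>{..<N}. 0::int"
  have v_pos: "0 < v i" if "i < N" for i
    using vc[OF that] d_pos by (metis mult_0 neq0_conv)
  \<comment> \<open>Positive weights make \<open>wt\<close> strictly monotone; extensionality puts
    the differing index below \<open>N\<close>.\<close>
  have less: "wt b < wt a'" if b: "b \<in> sols" and le: "\<forall>i<N. b i \<le> a' i"
    and "a' \<in> Pi\<^sub>E {..<N} A" "b \<noteq> a'" for b a' A
  proof -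
    obtain i where i: "b i \<noteq> a' i" using \<open>b \<noteq> a'\<close> by (auto simp: fun_eq_iff)
    have "i < N"
    proof (rule ccontr)
      assume "\<not> i < N"
      then have "b i = a' i"
        using \<open>b \<in> sols\<close> \<open>a' \<in> Pi\<^sub>E {..<N} A\<close>
        by (auto simp: sols_def PiE_iff extensional_def)
      then show False using i by simp
    qed
    have "b i < a' i" using le[rule_format, OF \<open>i < N\<close>] i by linarith
    then have "b i * int (v i) < a' i * int (v i)"
      by (rule mult_strict_right_mono) (simp add: v_pos[OF \<open>i < N\<close>])
    then have "\<exists>j\<in>{..<N}. b j * int (v j) < a' j * int (v j)"
      using \<open>i < N\<close> by (intro bexI[of _ i]) simp_all
    moreover have "\<forall>j\<in>{..<N}. b j * int (v j) \<le> a' j * int (v j)"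
    proof
      fix j assume "j \<in> {..<N}"
      then have "b j \<le> a' j" using le by simp
      then show "b j * int (v j) \<le> a' j * int (v j)" by (rule mult_right_mono) simp
    qed
    ultimately show ?thesis
      unfolding wt_def by (intro sum_strict_mono_ex1) (simp_all only: finite_lessThan)
  qed
  have pos: "0 < wt b" if "b \<in> sols" "b \<noteq> ?z" for b
  proof -
    have "wt ?z < wt b"
      using that zero_in_sols by (intro less[of _ _ "\<lambda>i. {0..<int (c i)}"])
        (auto simp: sols_def PiE_iff)
    then show ?thesis by (simp add: wt_def)
  qed
  have ex: "\<exists>b \<in> ?G a. b \<noteq> ?z \<and> b \<noteq> a'" if "N \<le> card (?G a)" for a a'
  proof (rule ccontr)
    assume "\<not> ?thesis"
    then have "?G a \<subseteq> {?z, a'}" by blast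
    then have "card (?G a) \<le> card {?z, a'}" by (intro card_mono) auto
    also have "\<dots> \<le> 2" by (simp add: card_insert_if)
    finally show False using that N by simp
  qed
  \<comment> \<open>The weight of such a \<open>b\<close> is a multiple of \<open>d\<close> strictly
    between 0 and \<open>(N - 1) * d\<close>.\<close>
  have fin: ?thesis if b: "b \<in> sols" "b \<noteq> ?z" "\<forall>i<N. b i \<le> a i" "wt b < (int N - 1) * int d" for b
  proof -
    obtain j where j: "wt b = int d * j" using b(1) by (auto simp: sols_def)
    have "0 < j" using pos[OF b(1,2)] j d_pos by (simp add: zero_less_mult_iff)
    moreover have "j < int N - 1" using b(4) j d_pos by (simp add: mult.commute)
    moreover have "\<forall>i<N. 0 \<le> b i" using b(1) by (auto simp: sols_def PiE_iff)
    ultimately show ?thesis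
      using b(3) j N by (intro exI[of _ b] exI[of _ "nat j"]) auto
  qed
  have sols_le: "wt b < int N * int d" if "b \<in> sols" for b
  proof -
    have "wt b < (\<Sum>i<N. int d)"
      unfolding wt_def
    proof (rule sum_strict_mono)
      fix i assume "i \<in> {..<N}"
      then have i: "i < N" by simp
      have "b i < int (c i)" using that i by (auto simp: sols_def PiE_iff)
      then have "b i * int (v i) < int (c i) * int (v i)" using v_pos[OF i] by simp
      also have "\<dots> = int d" using vc[OF i] by (metis of_nat_mult mult.commute)
      finally show "b i * int (v i) < int d" .
    qed (use N in \<open>auto simp: lessThan_empty_iff\<close>)
    then show ?thesis by simp
  qed
  obtain b where b: "b \<in> sols" "\<forall>i<N. b i \<le> a i" "b \<noteq> ?z"
    using ex[OF card_below[OF a wt]] by blast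
  show ?thesis
  proof (cases "wt b < (int N - 1) * int d")
    case True
    then show ?thesis using b by (intro fin)
  next
    \<comment> \<open>A multiple of \<open>d\<close> that is at least \<open>(N - 1) * d\<close> and
      below \<open>N * d\<close> can only be \<open>(N - 1) * d\<close>.\<close>
    case False
    obtain j where j: "wt b = int d * j" using b(1) by (auto simp: sols_def)
    have "j < int N" using sols_le[OF b(1)] j d_pos by (simp add: mult.commute)
    then have "int d * j \<le> int d * (int N - 1)" by (intro mult_left_mono) auto
    then have wb: "wt b = (int N - 1) * int d" using False j by (simp add: mult.commute)
    have "N \<le> card (?G b)"
      using b(1) wb by (intro card_below) (auto simp: sols_def PiE_iff)
    then obtain b' where b': "b' \<in> sols" "\<forall>i<N. b' i \<le> b i" "b' \<noteq> ?z" "b' \<noteq> b"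
      using ex by blast
    have "wt b' < wt b" using b b' by (intro less[of _ _ "\<lambda>i. {0..<int (c i)}"]) (auto simp: sols_def)
    then show ?thesis using b b' wb by (intro fin[of b']) (auto intro: order_trans)
  qed
qed

end

section \<open>Splitting multisets of weights\<close>

text \<open>Exponent vectors are encoded as multisets of indices, so that splitting a monomial
  becomes a multiset sum; this is the dot product of the multiplicities with
  \<open>u\<close>.\<close>

definition mwt :: "('i \<Rightarrow> nat) \<Rightarrow> 'i multiset \<Rightarrow> nat" where
  "mwt u M = (\<Sum>i\<in>#M. u i)"

lemma mwt_simps [simp]:
  "mwt u {#} = 0" "mwt u (add_mset i M) = u i + mwt u M" "mwt u (A + B) = mwt u A + mwt u B"
  "mwt u (replicate_mset n i) = n * u i" "mwt u (image_mset f M) = mwt (\<lambda>i. u (f i)) M"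
  by (simp_all add: mwt_def image_mset.compositionality o_def)

lemma mwt_sum_count:
  assumes "finite I" "set_mset M \<subseteq> I"
  shows "mwt u M = (\<Sum>i\<in>I. count M i * u i)"
  using assms(2)
proof (induction M)
  case (add x M)
  then have "(\<Sum>i\<in>I. count (add_mset x M) i * u i)
      = (\<Sum>i\<in>I. (if i = x then u i else 0) + count M i * u i)"
    by (intro sum.cong) auto
  also have "\<dots> = u x + (\<Sum>i\<in>I. count M i * u i)"
    using add.prems assms(1) by (simp add: sum.distrib)
  finally show ?case using add by simp
qed simp

text \<open>Proportional weight systems, cross-multiplied to stay within the naturals.\<close>

lemma mwt_mult: "(\<And>i. i \<in># M \<Longrightarrow> u i * p = q * u' i) \<Longrightarrow> mwt u M * p = q * mwt u' M"
  by (induction M) (simp_all add: algebra_simps)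

text \<open>Greedy removal: while some \<open>i\<close> occurs at least \<open>c i\<close> times,
  \<open>c i\<close> copies of it form a piece of weight \<open>d\<close>.\<close>

lemma extract_units:
  fixes u c :: "'i \<Rightarrow> nat"
  assumes "\<And>i. i \<in># M \<Longrightarrow> 0 < c i \<and> c i * u i = d"
  shows "\<exists>U R. M = \<Sum>\<^sub># U + R \<and> (\<forall>B\<in>#U. mwt u B = d) \<and> (\<forall>i\<in>#M. count R i < c i)"
  using assms
proof (induction "size M" arbitrary: M rule: less_induct)
  case less
  show ?case
  proof (cases "\<forall>i\<in>#M. count M i < c i")
    case True
    then show ?thesis by (intro exI[of _ "{#}"] exI[of _ M]) auto
  next
    case False
    then obtain i where i: "i \<in># M" "c i \<le> count M i" by (auto simp: not_less)
    let ?C = "replicate_mset (c i) i"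
    define M' where "M' = M - ?C"
    have M: "M = ?C + M'"
      using i(2) unfolding M'_def count_le_replicate_mset_subset_eq by simp
    have "size M' < size M" "\<And>j. j \<in># M' \<Longrightarrow> 0 < c j \<and> c j * u j = d"
      using less.prems i(1) by (auto simp: M)
    then obtain U R where UR: "M' = \<Sum>\<^sub># U + R" "\<forall>B\<in>#U. mwt u B = d" "\<forall>i\<in>#M'. count R i < c i"
      using less.hyps by metis
    have "count R j < c j" if j: "j \<in># M" for j
    proof (cases "j \<in># M'")
      case False
      then have "count R j = 0" using UR(1) by (auto simp: not_in_iff)
      then show ?thesis using less.prems[OF j] by simp
    qed (use UR in auto)
    moreover have "mwt u ?C = d" using less.prems[OF i(1)] by simp
    ultimately show ?thesis using UR M
      by (intro exI[of _ "add_mset ?C U"] exI[of _ R]) (auto simp: ac_simps)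
  qed
qed

lemma mwt_Union_units: "\<forall>B\<in>#U. mwt u B = d \<Longrightarrow> mwt u (\<Sum>\<^sub># U) = size U * d"
  by (induction U) auto

lemma size_split_mset:
  fixes U :: "'i multiset"
  assumes "j \<le> size U"
  obtains U1 U2 where "U = U1 + U2" "size U1 = j"
proof -
  obtain xs where xs: "mset xs = U" using ex_mset by blast
  show ?thesis
    using assms xs by (intro that[of "mset (take j xs)" "mset (drop j xs)"])
      (auto simp flip: mset_append)
qed

text \<open>The index \<open>length v\<close> stands for an additional entry equal to the least common multiple.\<close>

lemma split_exact:
  fixes v :: "nat list"
  defines "N \<equiv> length v" and "d \<equiv> Lcm (set v)"
  assumes wf: "well_formed v" and k: "1 \<le> k" "N \<le> k + 2"
    and M: "set_mset M \<subseteq> {..N}" and wtM: "2 * k * d \<le> mwt (\<lambda>i. (v @ [d]) ! i) M"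
  shows "\<exists>B C. M = B + C \<and> mwt (\<lambda>i. (v @ [d]) ! i) B = k * d"
proof -
  define u where "u i = (v @ [d]) ! i" for i
  define c where "c i = d div u i" for i
  have pv: "pos_vec v" using wf by (simp add: well_formed_def)
  have d: "0 < d" unfolding d_def by (rule Lcm_pos_vec[OF pv])
  have u_dvd: "u i dvd d" if "i \<le> N" for i
    using that unfolding u_def d_def N_def by (cases "i = length v") (auto simp: nth_append)
  have uc: "u i * c i = d" if "i \<le> N" for i
    using u_dvd[OF that] by (simp add: c_def)
  have c_pos: "0 < c i" if "i \<le> N" for i
    using uc[OF that] d by (metis mult_0_right neq0_conv)
  have cN: "c N = 1" using d by (simp add: c_def u_def N_def)
  obtain U R where MUR: "M = \<Sum>\<^sub># U + R" and U: "\<forall>B\<in>#U. mwt u B = d"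
    and R: "\<forall>i\<in>#M. count R i < c i"
    using extract_units[of M c u d] uc c_pos M by (metis atMost_iff mult.commute subsetD)
  show ?thesis
  proof (cases "k \<le> size U")
    case True
    then obtain U1 U2 where U12: "U = U1 + U2" "size U1 = k" by (rule size_split_mset)
    then have "mwt u (\<Sum>\<^sub># U1) = k * d" using U mwt_Union_units[of U1 u d] by simp
    then show ?thesis using MUR U12 unfolding u_def
      by (intro exI[of _ "\<Sum>\<^sub># U1"] exI[of _ "\<Sum>\<^sub># U2 + R"]) (simp add: ac_simps)
  next
    case False
    have RM: "set_mset R \<subseteq> set_mset M" using MUR by auto
    have countR: "count R i < c i" if "i \<le> N" for i
    proof (cases "i \<in># R")
      case False
      then show ?thesis using c_pos[OF that] by (simp add: not_in_iff)
    qed (use R RM in auto)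
    \<comment> \<open>Since \<open>c N = 1\<close>, every occurrence of the extra index is a unit by
      itself, so none remains in \<open>R\<close>.\<close>
    have "N \<notin># R" using countR[of N] cN by (simp add: not_in_iff)
    then have RN: "set_mset R \<subseteq> {..<N}" using RM M by (force simp: le_less)
    have wtR: "mwt u R = (\<Sum>i<N. count R i * u i)"
      using RN by (intro mwt_sum_count) auto
    \<comment> \<open>With at most \<open>k - 1\<close> units, the remainder must carry at least
      \<open>(k + 1) * d\<close>.\<close>
    have "2 * k * d \<le> size U * d + mwt u R"
      using wtM mwt_Union_units[OF U] unfolding MUR u_def[symmetric] by simp
    moreover have "size U * d \<le> (k - 1) * d" using False by (intro mult_right_mono) auto
    moreover have "2 * k * d = (k - 1) * d + (k + 1) * d"
      using k unfolding add_mult_distrib[symmetric] by simp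
    ultimately have wtR_ge: "(k + 1) * d \<le> mwt u R" by linarith
    have "N \<noteq> 0" using pv by (simp add: pos_vec_def N_def)
    \<comment> \<open>Each index below \<open>N\<close> contributes less than \<open>d\<close> to
      \<open>R\<close>; hence \<open>k + 1 < N\<close>, which pins down
      \<open>N = k + 2\<close>.\<close>
    then have "mwt u R < (\<Sum>i<N. d)" unfolding wtR
    proof (intro sum_strict_mono)
      fix i assume "i \<in> {..<N}"
      then have i: "i \<le> N" by simp
      have "0 < u i" using uc[OF i] d by (metis mult_0 neq0_conv)
      with countR[OF i] have "count R i * u i < c i * u i" by (rule mult_strict_right_mono)
      also have "c i * u i = d" using uc[OF i] by (simp only: mult.commute)
      finally show "count R i * u i < d" .
    qed auto
    with wtR_ge have "(k + 1) * d < N * d" unfolding sum_constant card_lessThan by simp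
    then have "k + 1 < N" by (rule mult_less_cancel2[THEN iffD1, THEN conjunct2])
    then have N: "N = k + 2" using k by simp
    \<comment> \<open>One unit fewer would push the weight of \<open>R\<close> up to
      \<open>N * d\<close>, which was just excluded. The exact number matters below: a part of
      weight \<open>j * d\<close> with \<open>j \<ge> 1\<close> is completed by \<open>k - j\<close>
      units.\<close>
    have h: "size U = k - 1"
    proof (rule ccontr)
      assume "size U \<noteq> k - 1"
      then have "size U + 2 \<le> k" using False by simp
      then have "(size U + 2) * d \<le> k * d" by (rule mult_right_mono) simp
      then have "(k + 2) * d \<le> mwt u R"
        using \<open>2 * k * d \<le> size U * d + mwt u R\<close> by (simp add: algebra_simps)
      then show False using \<open>mwt u R < (\<Sum>i<N. d)\<close> N by simp
    qed
    interpret weighted_box N d u c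
    proof
      show "u i * c i = d" if "i < N" for i using that uc by simp
      show "0 < d" by (rule d)
      show "Gcd (u ` ({..<N} - {i})) = 1" if i: "i < N" for i
      proof -
        \<comment> \<open>This excludes the exceptional alternative of \<open>well_formed\<close>,
          which says nothing about the gcd of the other entries.\<close>
        have "length v \<noteq> 1" using N k by (simp add: N_def)
        then have "Gcd ((!) v ` ({..<N} - {i})) = 1"
          using wf i unfolding well_formed_def N_def by (auto simp: card_Diff_singleton_if)
        moreover have "u ` ({..<N} - {i}) = (!) v ` ({..<N} - {i})"
          by (intro image_cong) (auto simp: u_def N_def nth_append)
        ultimately show ?thesis by simp
      qed
    qed
    have "\<exists>b j. (\<forall>i<N. 0 \<le> b i \<and> b i \<le> int (count R i)) \<and> 1 \<le> j \<and> j \<le> N - 2 \<and>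
        wt b = int j * int d"
    proof (rule intermediate_solution)
      have "wt (\<lambda>i. int (count R i)) = int (mwt u R)" unfolding wtR wt_def by simp
      also have "\<dots> \<ge> int ((k + 1) * d)" using wtR_ge unfolding of_nat_le_iff .
      finally show "(int N - 1) * int d \<le> wt (\<lambda>i. int (count R i))"
        by (simp add: N algebra_simps)
    qed (use N k countR in auto)
    then obtain b j where b: "\<forall>i<N. 0 \<le> b i \<and> b i \<le> int (count R i)" and j: "1 \<le> j" "j \<le> k"
      and wtb: "wt b = int j * int d" using N by auto
    define B where "B = (\<Sum>i<N. replicate_mset (nat (b i)) i)"
    have countB: "count B i = (if i < N then nat (b i) else 0)" for i
      by (simp add: B_def count_sum)
    have BR: "B \<subseteq># R" using b by (auto simp: subseteq_mset_def countB nat_le_iff)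
    then have "mwt u B = (\<Sum>i<N. count B i * u i)"
      using RN set_mset_mono by (intro mwt_sum_count) fastforce+
    then have "int (mwt u B) = wt b" using b by (simp add: wt_def countB)
    then have wtB: "mwt u B = j * d" unfolding wtb by (metis of_nat_eq_iff of_nat_mult)
    have "k - j \<le> size U" using h j by simp
    then obtain U1 U2 where U12: "U = U1 + U2" "size U1 = k - j" by (rule size_split_mset)
    then have "mwt u (B + \<Sum>\<^sub># U1) = j * d + (k - j) * d" using U wtB mwt_Union_units[of U1 u d] by simp
    also have "j * d + (k - j) * d = k * d" using j unfolding add_mult_distrib[symmetric] by simp
    finally have "mwt u (B + \<Sum>\<^sub># U1) = k * d" .
    moreover have "M = (B + \<Sum>\<^sub># U1) + (\<Sum>\<^sub># U2 + (R - B))"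
      using MUR U12 subset_mset.add_diff_inverse[OF BR] by (simp add: ac_simps)
    ultimately show ?thesis unfolding u_def by blast
  qed
qed

text \<open>Equal denominators match every \<open>w ! i\<close> with an entry of
  \<open>v @ [d]\<close> in the fixed ratio \<open>e : d\<close>. Relabelling indices along this
  matching \<open>f\<close> rescales all weights uniformly, and a splitting of the image multiset
  lifts back even if \<open>f\<close> is not injective.\<close>

lemma split_exact_transfer:
  fixes v w :: "nat list"
  assumes wf: "well_formed v" and w: "pos_vec w" and eq: "denominators v = denominators w"
    and k: "1 \<le> k" "length v \<le> k + 2"
    and A: "set_mset A \<subseteq> {..<length w}" and wtA: "2 * k * Lcm (set w) \<le> mwt ((!) w) A"
  shows "\<exists>B C. A = B + C \<and> mwt ((!) w) B = k * Lcm (set w)"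
proof -
  define d e where "d = Lcm (set v)" and "e = Lcm (set w)"
  have pv: "pos_vec v" using wf by (simp add: well_formed_def)
  have d: "0 < d" unfolding d_def by (rule Lcm_pos_vec[OF pv])
  have e: "0 < e" unfolding e_def by (rule Lcm_pos_vec[OF w])
  have "\<exists>j\<le>length v. w ! i * d = e * (v @ [d]) ! j" if i: "i < length w" for i
  proof -
    have "w ! i dvd e" using i by (simp add: e_def)
    then have wi: "w ! i * (e div w ! i) = e" by simp
    have "e div w ! i \<in> denominators v" unfolding eq unfolding denominators_def e_def
      using nth_mem[OF i] by blast
    then consider "e div w ! i = 1" | a where "a \<in> set v" "e div w ! i = d div a"
      unfolding denominators_def d_def by auto
    then show ?thesis
    proof cases
      \<comment> \<open>Quotient 1 means \<open>w ! i = e\<close>, which corresponds to the extra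
        entry \<open>d\<close> at index \<open>length v\<close>.\<close>
      case 1
      then show ?thesis using wi by (intro exI[of _ "length v"]) simp
    next
      case 2
      then obtain j where j: "j < length v" "a = v ! j" by (auto simp: in_set_conv_nth)
      have "a dvd d" using 2 by (simp add: d_def)
      then have "w ! i * d = (w ! i * (d div a)) * a" by (simp add: mult.assoc)
      also have "w ! i * (d div a) = e" using wi 2 by simp
      finally show ?thesis using j by (intro exI[of _ j]) (simp add: nth_append)
    qed
  qed
  then obtain f where f: "\<And>i. i < length w \<Longrightarrow> f i \<le> length v \<and> w ! i * d = e * (v @ [d]) ! f i"
    by metis
  have wt: "mwt ((!) w) B * d = e * mwt (\<lambda>j. (v @ [d]) ! j) (image_mset f B)"
    if "B \<subseteq># A" for B
    unfolding mwt_simps using f A set_mset_mono[OF that] by (intro mwt_mult) auto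
  have "e * (2 * k * d) = (2 * k * e) * d" by simp
  also have "\<dots> \<le> mwt ((!) w) A * d" using wtA by (intro mult_right_mono) (auto simp: e_def)
  also have "\<dots> = e * mwt (\<lambda>j. (v @ [d]) ! j) (image_mset f A)" by (rule wt) simp
  finally have "2 * k * d \<le> mwt (\<lambda>j. (v @ [d]) ! j) (image_mset f A)"
    using e by (metis mult_le_cancel1)
  moreover have "set_mset (image_mset f A) \<subseteq> {..length v}" using A f by auto
  ultimately obtain B C where BC: "image_mset f A = B + C"
      "mwt (\<lambda>j. (v @ [d]) ! j) B = k * d"
    using split_exact[OF wf k] unfolding d_def by meson
  obtain B' C' where B': "A = B' + C'" "B = image_mset f B'"
    using image_mset_eq_plusD[OF BC(1)] by blast
  have "mwt ((!) w) B' * d = e * (k * d)" using wt[of B'] B' BC by simp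
  then have "mwt ((!) w) B' = k * e" using d by (simp add: mult.commute)
  then show ?thesis using B' by (auto simp: e_def)
qed

section \<open>Monomials of the Rees ring\<close>

definition mon :: "nat \<Rightarrow> nat multiset \<Rightarrow> rees_var \<Rightarrow>\<^sub>0 nat" where
  "mon e A = Poly_Mapping.single T e + (\<Sum>i\<in>#A. Poly_Mapping.single (X i) 1)"

lemma mon_add: "mon (e + e') (A + B) = mon e A + mon e' B"
  by (simp add: mon_def single_add ac_simps)

lemma mon_empty: "mon 0 {#} = 0"
  by (simp add: mon_def)

lemma lookup_mon_T [simp]: "Poly_Mapping.lookup (mon e A) T = e"
proof -
  have "Poly_Mapping.lookup (\<Sum>i\<in>#A. Poly_Mapping.single (X i) (1::nat)) T = 0"
    by (induction A) (simp_all add: lookup_add lookup_single)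
  then show ?thesis by (simp add: mon_def lookup_add)
qed

text \<open>The monomials spanning the Rees ring: each factor \<open>X i\<close> carries at most
  \<open>w ! i\<close> powers of \<open>T\<close>. The two inclusions are
  \<open>keys_rees_ring\<close> and \<open>monomial_in_rees_ring\<close>.\<close>

definition rees_exponents :: "nat list \<Rightarrow> (rees_var \<Rightarrow>\<^sub>0 nat) set" where
  "rees_exponents w = {mon e A | e A. set_mset A \<subseteq> {..<length w} \<and> e \<le> mwt ((!) w) A}"

lemma rees_exponents_add:
  assumes "a \<in> rees_exponents w" "b \<in> rees_exponents w"
  shows "a + b \<in> rees_exponents w"
proof -
  obtain e A e' B where "a = mon e A" "set_mset A \<subseteq> {..<length w}" "e \<le> mwt ((!) w) A"
    and "b = mon e' B" "set_mset B \<subseteq> {..<length w}" "e' \<le> mwt ((!) w) B"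
    using assms unfolding rees_exponents_def by blast
  then show ?thesis unfolding rees_exponents_def
    by (intro CollectI exI[of _ "e + e'"] exI[of _ "A + B"]) (auto simp: mon_add)
qed

lemma keys_rees_ring:
  assumes "p \<in> rees_ring w"
  shows "Poly_Mapping.keys p \<subseteq> rees_exponents w"
  using assms unfolding rees_ring_def
proof induction
  case (const c)
  have "0 \<in> rees_exponents w"
    unfolding rees_exponents_def by (intro CollectI exI[of _ 0] exI[of _ "{#}"]) (simp add: mon_empty)
  then show ?case by auto
next
  case (gen g)
  then obtain d i where g: "g = var T ^ d * var (X i)" "i < length w" "d \<le> w ! i" by blast
  have "g = Poly_Mapping.single (mon d {#i#}) 1"
    unfolding g var_T_power by (simp add: var_def mult_single mon_def)
  moreover have "mon d {#i#} \<in> rees_exponents w"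
    unfolding rees_exponents_def using g by (intro CollectI exI[of _ d] exI[of _ "{#i#}"]) simp
  ultimately show ?case by auto
next
  case (add p q)
  then show ?case using keys_add[of p q] by blast
next
  case (mult p q)
  then show ?case using keys_mult[of p q] rees_exponents_add by blast
qed

text \<open>The power of \<open>T\<close> is distributed greedily: the factor \<open>X i\<close>
  takes \<open>min e (w ! i)\<close>, and the rest still fits the remaining factors.\<close>

lemma monomial_in_rees_ring:
  assumes "set_mset A \<subseteq> {..<length w}" "e \<le> mwt ((!) w) A"
  shows "Poly_Mapping.single (mon e A) c \<in> rees_ring w"
  using assms
proof (induction A arbitrary: e)
  case empty
  then show ?case by (simp add: mon_empty rees_ring_def adjoin.const)
next
  case (add i A)
  define d where "d = min e (w ! i)"
  have "e - d \<le> mwt ((!) w) A" using add.prems by (auto simp: d_def)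
  then have IH: "Poly_Mapping.single (mon (e - d) A) c \<in> rees_ring w"
    using add.prems(1) by (intro add.IH) simp_all
  have "var T ^ d * var (X i) \<in> (rees_ring w :: 'a rees_poly set)"
    unfolding rees_ring_def using add.prems
    by (intro adjoin.gen CollectI exI[of _ d] exI[of _ i]) (simp add: d_def)
  then have "(var T ^ d * var (X i)) * Poly_Mapping.single (mon (e - d) A) c \<in> rees_ring w"
    using IH unfolding rees_ring_def by (rule adjoin.mult)
  moreover have "var T ^ d * var (X i) = (Poly_Mapping.single (mon d {#i#}) 1 :: 'a rees_poly)"
    unfolding var_T_power by (simp add: var_def mult_single mon_def)
  moreover have "mon d {#i#} + mon (e - d) A = mon e (add_mset i A)"
    using mon_add[of d "e - d" "{#i#}" A] by (simp add: d_def)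
  ultimately show ?case by (simp add: mult_single)
qed

lemma monomial_in_rees_component:
  assumes "set_mset A \<subseteq> {..<length w}" "e \<le> mwt ((!) w) A"
  shows "Poly_Mapping.single (mon e A) c \<in> rees_component w e"
  using monomial_in_rees_ring[OF assms, of c] unfolding rees_component_def
  by (auto simp: keys_single split: if_splits)

section \<open>Generation in degree 1 from splittings of monomials\<close>

lemma power_span_Suc:
  assumes x: "x \<in> A" and y: "y \<in> power_span A m"
  shows "x * y \<in> power_span A (Suc m)"
  using y unfolding power_span_def
proof induction
  case (base s)
  then consider "s = 0" | as where "s = prod_list as" "length as = m" "set as \<subseteq> A" by auto
  then show ?case
  proof cases
    case 2
    then show ?thesis using x by (intro group_closure.base insertI2 CollectI exI[of _ "x # as"]) auto
  qed simp
next
  case (diff s t)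
  then show ?case by (simp add: right_diff_distrib group_closure.diff)
qed

lemma group_closure_sum:
  "(\<And>i. i \<in> I \<Longrightarrow> f i \<in> group_closure S) \<Longrightarrow> sum f I \<in> group_closure S"
  by (induction I rule: infinite_finite_induct) (auto intro: group_closure_add)

lemma poly_mapping_sum_single:
  "(\<Sum>m\<in>Poly_Mapping.keys p. Poly_Mapping.single m (Poly_Mapping.lookup p m)) = p"
  by (intro poly_mapping_eqI) (auto simp: lookup_sum lookup_single when_def in_keys_iff)

text \<open>Multiplicativity of the grading gives the reverse of \<open>gen\<close>, so the power
  spans are the Veronese components themselves. Their directness is inherited from \<open>S\<close>
  by reindexing along multiplication by \<open>r\<close>.\<close>

lemma generated_in_degree_1_veroneseI:
  assumes S: "graded_ring S" and r: "0 < r"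
    and gen: "\<And>m. S (r * Suc m) \<subseteq> power_span (S r) (Suc m)"
  shows "generated_in_degree_1 (veronese r S)"
proof -
  have sub: "group_closure (S i) = S i" for i
    using S unfolding graded_ring_def is_direct_sum_def by blast
  have prod: "prod_list as \<in> S (r * length as)" if "set as \<subseteq> S r" for as
    using that
  proof (induction as)
    case Nil
    then show ?case using S unfolding graded_ring_def by simp
  next
    case (Cons a as)
    then have "a * prod_list as \<in> S (r + r * length as)"
      using S unfolding graded_ring_def by simp
    then show ?case by simp
  qed
  have le: "power_span (S r) m \<subseteq> S (r * m)" for m
  proof -
    have "x \<in> S (r * m)" if "x \<in> group_closure {prod_list as | as. length as = m \<and> set as \<subseteq> S r}" for x
      using that
    proof induction
      case (base s)
      then show ?case using prod zero_in_group_closure[of "S (r * m)"] sub by auto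
    next
      case (diff s t)
      then show ?case using group_closure.diff[of s "S (r * m)" t] sub group_closure.base by auto
    qed
    then show ?thesis by (auto simp: power_span_def)
  qed
  have eq: "(if m = 0 then veronese r S 0 else power_span (veronese r S 1) m) = veronese r S m" for m
    using le[of m] gen[of "m - 1"] by (cases m) (auto simp: veronese_def)
  have indep: "\<forall>m\<in>M. f m = 0" if "\<forall>m\<in>M. f m \<in> S m" "finite M" "sum f M = 0" for M f
    using S that unfolding graded_ring_def is_direct_sum_def by blast
  have "\<forall>m\<in>M. f m = 0"
    if "finite M" "\<forall>m\<in>M. f m \<in> S (r * m)" "sum f M = 0" for M f
  proof -
    have inj: "inj_on ((*) r) M" using r by (auto simp: inj_on_def)
    have "\<forall>n\<in>(*) r ` M. f (n div r) \<in> S n" "(\<Sum>n\<in>(*) r ` M. f (n div r)) = 0"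
      using that r by (auto simp: sum.reindex[OF inj])
    then have "\<forall>n\<in>(*) r ` M. f (n div r) = 0" using \<open>finite M\<close> by (intro indep) simp_all
    then show ?thesis using r by simp
  qed
  then show ?thesis
    unfolding generated_in_degree_1_def eq is_direct_sum_def graded_carrier_def
    by (simp add: veronese_def sub)
qed

text \<open>A factor of \<open>T\<close>-degree \<open>r\<close> is peeled off repeatedly. Its
  multiset \<open>B\<close> weighs exactly \<open>r\<close>, so it can carry \<open>T^r\<close>
  while the rest keeps enough weight for the remaining power of \<open>T\<close>. Weight
  \<open>2 * r\<close> suffices for \<open>split\<close>, because the last factor is taken whole,
  whatever its excess weight.\<close>

lemma rees_component_subset_power_span:
  assumes split: "\<And>A. set_mset A \<subseteq> {..<length w} \<Longrightarrow> 2 * r \<le> mwt ((!) w) A \<Longrightarrow>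
      \<exists>B C. A = B + C \<and> mwt ((!) w) B = r"
  shows "rees_component w (r * Suc m)
    \<subseteq> power_span (rees_component w r :: 'a::comm_ring_1 rees_poly set) (Suc m)"
proof
  let ?S = "rees_component w r :: 'a rees_poly set"
  have mono: "Poly_Mapping.single (mon (r * Suc m) A) c \<in> power_span ?S (Suc m)"
    if "set_mset A \<subseteq> {..<length w}" "r * Suc m \<le> mwt ((!) w) A" for A m c
    using that
  proof (induction m arbitrary: A)
    case 0
    then have "Poly_Mapping.single (mon r A) c \<in> ?S"
      by (intro monomial_in_rees_component) auto
    then show ?case unfolding power_span_def
      by (intro group_closure.base insertI2 CollectI exI[of _ "[Poly_Mapping.single (mon r A) c]"]) simp
  next
    case (Suc m)
    have "2 * r \<le> mwt ((!) w) A" using Suc.prems(2) by (simp add: algebra_simps)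
    then obtain B C where BC: "A = B + C" "mwt ((!) w) B = r" using split Suc.prems(1) by blast
    \<comment> \<open>The peeled factor has coefficient 1; \<open>c\<close> stays with the remaining
      monomial.\<close>
    have "Poly_Mapping.single (mon r B) 1 \<in> ?S"
      using BC Suc.prems by (intro monomial_in_rees_component) auto
    moreover have "Poly_Mapping.single (mon (r * Suc m) C) c \<in> power_span ?S (Suc m)"
      using BC Suc.prems by (intro Suc.IH) auto
    ultimately have "Poly_Mapping.single (mon r B) 1 * Poly_Mapping.single (mon (r * Suc m) C) c
        \<in> power_span ?S (Suc (Suc m))" by (rule power_span_Suc)
    then show ?case by (simp add: BC mult_single mon_add[symmetric])
  qed
  fix p :: "'a rees_poly" assume p: "p \<in> rees_component w (r * Suc m)"
  have "Poly_Mapping.single \<mu> (Poly_Mapping.lookup p \<mu>) \<in> power_span ?S (Suc m)"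
    if \<mu>: "\<mu> \<in> Poly_Mapping.keys p" for \<mu>
  proof -
    have "\<mu> \<in> rees_exponents w" using p \<mu> keys_rees_ring unfolding rees_component_def by blast
    then obtain e A where A: "\<mu> = mon e A" "set_mset A \<subseteq> {..<length w}" "e \<le> mwt ((!) w) A"
      unfolding rees_exponents_def by blast
    moreover have "e = r * Suc m" using p \<mu> A(1) by (auto simp: rees_component_def)
    ultimately show ?thesis using mono by simp
  qed
  then have "(\<Sum>\<mu>\<in>Poly_Mapping.keys p. Poly_Mapping.single \<mu> (Poly_Mapping.lookup p \<mu>))
      \<in> power_span ?S (Suc m)"
    unfolding power_span_def by (rule group_closure_sum)
  then show "p \<in> power_span ?S (Suc m)" unfolding poly_mapping_sum_single .
qed

theorem theorem1p28:
  fixes w :: "nat list" and k :: nat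
  assumes "w \<noteq> []"
    and "\<forall>a\<in>set w. 1 \<le> a"
    and "int k \<ge> max 1 (int (min_wf_length w) - 2)"
  shows "generated_in_degree_1
           (veronese (k * Lcm (set w)) (rees_component w :: nat \<Rightarrow> 'a::comm_ring_1 rees_poly set))"
proof -
  have w: "pos_vec w" using assms(1,2) by (auto simp: pos_vec_def Suc_le_eq)
  \<comment> \<open>Nonemptiness ensures that the least length is attained by some
    \<open>v\<close>.\<close>
  have "\<exists>N v. well_formed v \<and> strongly_equivalent v w \<and> length v = N"
    using well_formed_strongly_equivalent_exists[OF w] by blast
  then have "\<exists>v. well_formed v \<and> strongly_equivalent v w \<and> length v = min_wf_length w"
    unfolding min_wf_length_def by (rule LeastI_ex)
  then obtain v where v: "well_formed v" "strongly_equivalent v w" "length v = min_wf_length w"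
    by blast
  have k: "1 \<le> k" "length v \<le> k + 2" using assms(3) v(3) by linarith+
  show ?thesis
  proof (intro generated_in_degree_1_veroneseI graded_ring_rees rees_component_subset_power_span)
    show "0 < k * Lcm (set w)" using k Lcm_pos_vec[OF w] by simp
    show "\<exists>B C. A = B + C \<and> mwt ((!) w) B = k * Lcm (set w)"
      if "set_mset A \<subseteq> {..<length w}" "2 * (k * Lcm (set w)) \<le> mwt ((!) w) A" for A
      using split_exact_transfer[OF v(1) w strongly_equivalent_denominators[OF v(2)] k that(1)] that(2)
      by (simp add: mult.assoc)
  qed
qed

end
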